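(* Let $H_1:\ \dot x_1=f_1(x_1,u_1),\ y_1=h_1(x_1)$ and $H_2:\ \dot x_2=f_2(x_2,u_2),\ y_2=h_2(x_2,u_2)$ be single-input-single-output nonlinear negative imaginary (NNI) systems with storage functions $V_1:\mathbb{R}^{n_1}\to\mathbb{R}$ and $V_2:\mathbb{R}^{n_2}\to\mathbb{R}$ respectively, where $x_i\in\mathbb{R}^{n_i}$, $u_i,y_i\in\mathbb{R}$, $f_i:\mathbb{R}^{n_i}\times\mathbb{R}\to\mathbb{R}^{n_i}$ is Lipschitz continuous ($i=1,2$), and $h_1:\mathbb{R}^{n_1}\to\mathbb{R}$, $h_2:\mathbb{R}^{n_2}\times\mathbb{R}\to\mathbb{R}$ are of class $C^1$. Assume $f_1(0,0)=0$, $h_1(0)=0$, $f_2(0,0)=0$, $h_2(0,0)=0$. Define $$W(x_1,x_2)=V_1(x_1)+V_2(x_2)-\int_0^{h_1(x_1)}h_2(x_2,\xi)\,d\xi ,$$ and suppose there exists a compact neighborhood $\mathcal{D}\subset\mathbb{R}^{n_1}\times\mathbb{R}^{n_2}$ of $(0,0)$ such that $W(x_1,x_2)>0$ for all $(x_1,x_2)\in\mathcal{D}\setminus\{(0,0)\}$. Then the equilibrium $(x_1^*,x_2^* )=(0,0)$ of the feedback interconnection of $H_1$ and $H_2$ given by $u_1=y_2$, $u_2=y_1$, that is, of $$\dot x_1=f_1\big(x_1,h_2(x_2,h_1(x_1))\big),\qquad \dot x_2=f_2\big(x_2,h_1(x_1)\big),$$ is locally stable in the sense of Lyapunov.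
   Context: A system $\dot x=f(x,u)$, $y=h(x,u)$ with $x\in\mathbb{R}^n$, $u,y\in\mathbb{R}$ is called nonlinear negative imaginary (NNI) if there is a positive semidefinite storage function $V:\mathbb{R}^n\to\mathbb{R}$ of class $C^1$ (i.e. $V\ge 0$ and $V(0)=0$) such that along the system, for all $t\ge0$, $$\dot V(x)\le\int_0^u\frac{\partial}{\partial x}h(x,\xi)\,\dot x\,d\xi,$$ where $\dot x=f(x,u)$ and $\dot V(x)=\frac{\partial V}{\partial x}f(x,u)$; equivalently, the inequality holds for all $x\in\mathbb{R}^n$, $u\in\mathbb{R}$. When $h$ depends only on $x$, the inequality reads $\dot V(x)\le u\,\dot h(x)$ with $\dot h(x)=\frac{\partial h}{\partial x}f(x,u)$. An equilibrium $0$ of an autonomous system is locally stable in the sense of Lyapunov if for every $\varepsilon>0$ there is $\delta>0$ such that every solution starting with norm less than $\delta$ stays within norm $\varepsilon$ for all $t\ge 0$. *)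

theory Defs
  imports "HOL-Analysis.Analysis"
begin

definition C1 :: "('a::real_normed_vector \<Rightarrow> 'b::real_normed_vector) \<Rightarrow> bool" where
  "C1 f \<longleftrightarrow> (\<exists>f' :: 'a \<Rightarrow> 'a \<Rightarrow>\<^sub>L 'b.
     (\<forall>x. (f has_derivative blinfun_apply (f' x)) (at x)) \<and> continuous_on UNIV f')"

(* The dissipation inequality is imposed pointwise in the state x and the input u, with
   f (x, u) substituted for the time derivative of x; in the integral it stays frozen at the
   upper limit u and only the second argument of h varies.
   LBINT is the oriented integral, so u < 0 is covered.
   An output map depending on the state alone is passed as "\<lambda>(x, u). h x". *)
definition NNI_with_storage ::
  "('a::euclidean_space \<times> real \<Rightarrow> 'a) \<Rightarrow> ('a \<times> real \<Rightarrow> real) \<Rightarrow> ('a \<Rightarrow> real) \<Rightarrow> bool" where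
  "NNI_with_storage f h V \<longleftrightarrow>
     C1 V \<and> (\<forall>x. 0 \<le> V x) \<and> V 0 = 0 \<and>
     (\<forall>x u. frechet_derivative V (at x) (f (x, u))
        \<le> (LBINT \<xi>=ereal 0..ereal u. frechet_derivative (\<lambda>z. h (z, \<xi>)) (at x) (f (x, u))))"

definition feedback_interconnection ::
  "('a \<times> real \<Rightarrow> 'a) \<Rightarrow> ('a \<Rightarrow> real) \<Rightarrow> ('b \<times> real \<Rightarrow> 'b) \<Rightarrow> ('b \<times> real \<Rightarrow> real)
     \<Rightarrow> 'a \<times> 'b \<Rightarrow> 'a \<times> 'b" where
  "feedback_interconnection f1 h1 f2 h2 =
     (\<lambda>(x1, x2). (f1 (x1, h2 (x2, h1 x1)), f2 (x2, h1 x1)))"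

definition interconnection_storage ::
  "('a \<Rightarrow> real) \<Rightarrow> ('b \<Rightarrow> real) \<Rightarrow> ('a \<Rightarrow> real) \<Rightarrow> ('b \<times> real \<Rightarrow> real) \<Rightarrow> 'a \<times> 'b \<Rightarrow> real" where
  "interconnection_storage V1 V2 h1 h2 =
     (\<lambda>(x1, x2). V1 x1 + V2 x2 - (LBINT \<xi>=ereal 0..ereal (h1 x1). h2 (x2, \<xi>)))"

definition solution_on :: "('a::real_normed_vector \<Rightarrow> 'a) \<Rightarrow> real set \<Rightarrow> (real \<Rightarrow> 'a) \<Rightarrow> bool" where
  "solution_on F J x \<longleftrightarrow> (\<forall>t\<in>J. (x has_vector_derivative F (x t)) (at t within J))"

(* J ranges over all forward time intervals, bounded or not: solutions that are not known to
   exist for all t \<ge> 0 are constrained on their whole interval of existence. *)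
definition lyapunov_stable_0 :: "('a::real_normed_vector \<Rightarrow> 'a) \<Rightarrow> bool" where
  "lyapunov_stable_0 F \<longleftrightarrow> F 0 = 0 \<and>
     (\<forall>\<epsilon>>0. \<exists>\<delta>>0. \<forall>J x. is_interval J \<and> 0 \<in> J \<and> J \<subseteq> {0..} \<and> solution_on F J x \<and> norm (x 0) < \<delta>
        \<longrightarrow> (\<forall>t\<in>J. norm (x t) < \<epsilon>))"

end

theory Submission
  imports Defs
begin

text \<open>The function $W$ is a Lyapunov function. By the Leibniz rule and the fundamental theorem of
  calculus, its derivative along the interconnection is
  $\dot V_1 + \dot V_2 - h_2(x_2, h_1(x_1))\, \dot h_1 - \int_0^{h_1(x_1)} \partial_x h_2(x_2, \xi)\, \dot x_2 \, d\xi$,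
  which is at most $0$ by the two dissipation inequalities, since $u_1 = h_2(x_2, h_1(x_1))$ and
  $u_2 = h_1(x_1)$. Stability follows because a trajectory that starts where $W$ is smaller
  than its minimum over a small sphere inside $D$ cannot cross that sphere.\<close>

section \<open>Differentiation of oriented integrals in a parameter and in the upper limit\<close>

lemma interval_integral_continuous_eq:
  fixes f :: "real \<Rightarrow> real"
  assumes "continuous_on UNIV f"
  shows "(LBINT t=ereal a..ereal b. f t) =
    (if a \<le> b then integral {a..b} f else - integral {b..a} f)"
proof -
  \<comment> \<open>The target is the gauge integral \<open>integral\<close>, the one for which
    \<open>leibniz_rule\<close> is stated; the opposite orientation then costs only a sign.\<close>
  have le: "(LBINT t=ereal c..ereal d. f t) = integral {c..d} f" if "c \<le> d" for c d
    using that assms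
    by (intro interval_integral_eq_integral borel_integrable_atLeastAtMost')
      (auto intro: continuous_on_subset)
  show ?thesis
    using le[of a b] le[of b a] interval_integral_endpoints_reverse[of "ereal a" "ereal b" f]
    by auto
qed

lemma continuous_on_section:
  assumes "continuous_on UNIV (\<lambda>(x, t). g x t)"
  shows "continuous_on UNIV (g x)"
proof -
  have "continuous_on UNIV (Pair x)"
    by (intro continuous_intros)
  from continuous_on_compose2[OF assms this] show ?thesis
    by simp
qed

text \<open>Differentiation under the integral sign yields the integral of the operator-valued map
  \<open>hx x\<close>. Evaluation at \<open>v\<close> commutes with that integral, which brings the
  derivative into the pointwise form used in the dissipation inequality.\<close>

lemma has_derivative_integral_parameter:
  fixes h :: "'a::banach \<Rightarrow> real \<Rightarrow> real"
  assumes der: "\<And>x t. ((\<lambda>x. h x t) has_derivative blinfun_apply (hx x t)) (at x)"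
    and cont_hx: "continuous_on UNIV (\<lambda>(x, t). hx x t)"
    and cont_h: "\<And>x. continuous_on UNIV (h x)"
  shows "((\<lambda>x. integral {a..b} (h x)) has_derivative (\<lambda>v. integral {a..b} (\<lambda>t. hx x t v))) (at x)"
proof -
  have cont: "continuous_on UNIV (hx x)"
    by (rule continuous_on_section[OF cont_hx])
  have "((\<lambda>x. integral (cbox a b) (h x)) has_derivative blinfun_apply (integral (cbox a b) (hx x)))
    (at x within UNIV)"
  proof (rule leibniz_rule)
    show "h y integrable_on cbox a b" for y
      using cont_h by (intro integrable_continuous) (auto intro: continuous_on_subset)
    show "continuous_on (UNIV \<times> cbox a b) (\<lambda>(x, t). hx x t)"
      using cont_hx by (rule continuous_on_subset) auto
  qed (use der in auto)
  moreover have "blinfun_apply (integral (cbox a b) (hx x)) =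
    (\<lambda>v. integral (cbox a b) (\<lambda>t. hx x t v))"
    unfolding fun_eq_iff
    by (intro allI blinfun_apply_integral integrable_continuous continuous_on_subset[OF cont]) auto
  ultimately show ?thesis
    by simp
qed

lemma has_derivative_interval_integral_parameter:
  fixes h :: "'a::banach \<Rightarrow> real \<Rightarrow> real"
  assumes der: "\<And>x t. ((\<lambda>x. h x t) has_derivative blinfun_apply (hx x t)) (at x)"
    and cont_hx: "continuous_on UNIV (\<lambda>(x, t). hx x t)"
    and cont_h: "\<And>x. continuous_on UNIV (h x)"
  shows "((\<lambda>x. LBINT t=ereal a..ereal b. h x t) has_derivative
    (\<lambda>v. LBINT t=ereal a..ereal b. hx x t v)) (at x)"
proof -
  have "continuous_on UNIV (\<lambda>t. hx x t v)" for v
    using continuous_on_section[OF cont_hx] by (auto intro!: continuous_intros)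
  \<comment> \<open>The Leibniz rule on \<open>{a..b}\<close> serves the case
    \<open>a \<le> b\<close>; its negative on \<open>{b..a}\<close> serves the reversed
    orientation.\<close>
  then show ?thesis
    using has_derivative_integral_parameter[OF der cont_hx cont_h, of a b x]
      has_derivative_minus[OF has_derivative_integral_parameter[OF der cont_hx cont_h, of b a x]]
    by (cases "a \<le> b") (simp_all add: interval_integral_continuous_eq cont_h)
qed

lemma interval_integral_has_real_derivative:
  fixes f :: "real \<Rightarrow> real"
  assumes "continuous_on UNIV f"
  shows "((\<lambda>u. LBINT t=ereal a..ereal u. f t) has_real_derivative f u) (at u)"
proof -
  \<comment> \<open>The margin 1 puts \<open>u\<close> in the interior of \<open>{l..r}\<close>, so
    that the derivative within this interval is the full derivative at \<open>u\<close>.\<close>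
  define l r where "l = min a u - 1" and "r = max a u + 1"
  have "((\<lambda>u. LBINT t=ereal a..ereal u. f t) has_vector_derivative f u) (at u within {l..r})"
    by (rule interval_integral_FTC2) (use assms in \<open>auto simp: l_def r_def intro: continuous_on_subset\<close>)
  moreover have "at u within {l..r} = at u"
    by (rule at_within_interior) (auto simp: l_def r_def)
  ultimately show ?thesis
    by (simp add: has_real_derivative_iff_has_vector_derivative)
qed

text \<open>Total differentiability is obtained from the partial derivatives: the one in the
  parameter at the given point, by the Leibniz rule, and the one in the upper limit everywhere, by
  the fundamental theorem. The latter is multiplication by \<open>h x u\<close>, which is jointly
  continuous.\<close>

lemma has_derivative_interval_integral_upper_parameter:
  fixes h :: "'a::banach \<Rightarrow> real \<Rightarrow> real"
  assumes der: "\<And>x t. ((\<lambda>x. h x t) has_derivative blinfun_apply (hx x t)) (at x)"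
    and cont_hx: "continuous_on UNIV (\<lambda>(x, t). hx x t)"
    and cont_h: "continuous_on UNIV (\<lambda>(x, t). h x t)"
  shows "((\<lambda>(x, u). LBINT t=ereal a..ereal u. h x t) has_derivative
    (\<lambda>(v, w). (LBINT t=ereal a..ereal u. hx x t v) + h x u * w)) (at (x, u))"
proof -
  have cont: "continuous_on UNIV (h y)" for y
    by (rule continuous_on_section[OF cont_h])
  have "((\<lambda>(x, u). LBINT t=ereal a..ereal u. h x t) has_derivative
    (\<lambda>(v, w). (LBINT t=ereal a..ereal u. hx x t v) + blinfun_mult_right (h x u) w))
    (at (x, u) within UNIV \<times> UNIV)"
  proof (rule has_derivative_partialsI)
    show "((\<lambda>x. LBINT t=ereal a..ereal u. h x t) has_derivative
      (\<lambda>v. LBINT t=ereal a..ereal u. hx x t v)) (at x within UNIV)"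
      by (rule has_derivative_interval_integral_parameter[OF der cont_hx cont])
    show "((\<lambda>u. LBINT t=ereal a..ereal u. h y t) has_derivative blinfun_mult_right (h y u))
      (at u within UNIV)" for y u
      using interval_integral_has_real_derivative[OF cont]
      by (simp add: has_field_derivative_def)
    have "continuous (at (x, u)) (\<lambda>(x, t). h x t)"
      using cont_h by (simp add: continuous_on_eq_continuous_at)
    then show "continuous (at (x, u) within UNIV \<times> UNIV) (\<lambda>(x, u). blinfun_mult_right (h x u))"
      unfolding split_beta UNIV_Times_UNIV
      by (rule bounded_linear.continuous[OF bounded_linear_blinfun_mult_right])
  qed auto
  then show ?thesis
    by simp
qed

text \<open>The partial derivative is the total derivative composed with the embedding of
  \<open>v\<close> as \<open>(v, 0)\<close>. Composition of bounded linear maps is continuous in the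
  operator norm, so continuity carries over.\<close>

lemma C1_partial:
  fixes h :: "'a::real_normed_vector \<times> real \<Rightarrow> real"
  assumes "C1 h"
  obtains hx where "\<And>x t. ((\<lambda>x. h (x, t)) has_derivative blinfun_apply (hx x t)) (at x)"
    and "continuous_on UNIV (\<lambda>(x, t). hx x t)"
proof -
  obtain h' where h': "\<And>z. (h has_derivative blinfun_apply (h' z)) (at z)"
    and cont: "continuous_on UNIV h'"
    using assms unfolding C1_def by blast
  define i :: "'a \<Rightarrow>\<^sub>L ('a \<times> real)" where "i = Blinfun (\<lambda>v. (v, 0))"
  have i: "blinfun_apply i v = (v, 0)" for v
    unfolding i_def by (simp add: bounded_linear_Blinfun_apply bounded_linear_intros)
  show ?thesis
  proof
    have "blinfun_apply (h' (x, t) o\<^sub>L i) = (\<lambda>v. h' (x, t) (v, 0))" for x t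
      by (simp add: fun_eq_iff i)
    then show "((\<lambda>x. h (x, t)) has_derivative blinfun_apply (h' (x, t) o\<^sub>L i)) (at x)" for x t
      using has_derivative_compose[of "\<lambda>x. (x, t)" "\<lambda>v. (v, 0)" x UNIV h, OF _ h']
      by (simp add: has_derivative_Pair has_derivative_ident)
    show "continuous_on UNIV (\<lambda>(x, t). h' (x, t) o\<^sub>L i)"
      using cont by (auto simp: split_beta intro!: continuous_intros)
  qed
qed

section \<open>Lyapunov's direct method\<close>

lemma nonincreasing_along_solution:
  fixes W :: "'a::real_normed_vector \<Rightarrow> real"
  assumes W': "\<And>z. (W has_derivative W' z) (at z)"
    and W'_nonpos: "\<And>z. W' z (F z) \<le> 0"
    and sol: "solution_on F J x" and J: "{a..b} \<subseteq> J" and "a \<le> b"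
  shows "W (x b) \<le> W (x a)"
proof -
  have "((W \<circ> x) has_derivative (\<lambda>s. s * W' (x t) (F (x t)))) (at t within {a..b})"
    if "a \<le> t" "t \<le> b" for t
  proof -
    have "t \<in> J"
      using J that by auto
    then have "(x has_vector_derivative F (x t)) (at t within J)"
      using sol by (simp add: solution_on_def)
    then have "(x has_vector_derivative F (x t)) (at t within {a..b})"
      using J by (rule has_vector_derivative_within_subset)
    then have "((W \<circ> x) has_vector_derivative W' (x t) (F (x t))) (at t within {a..b})"
      by (rule vector_derivative_diff_chain_within) (rule has_derivative_at_withinI[OF W'])
    then show ?thesis
      by (simp add: has_vector_derivative_def)
  qed
  \<comment> \<open>Mean value theorem for the composition \<open>W \<circ> x\<close>, whose
    derivative at \<open>t\<close> is the linear map with slope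
    \<open>W' (x t) (F (x t))\<close>.\<close>
  then have "\<exists>t\<in>{a..b}. (W \<circ> x) b - (W \<circ> x) a = (b - a) * W' (x t) (F (x t))"
    using \<open>a \<le> b\<close> by (intro mvt_very_simple)
  then obtain t where "W (x b) - W (x a) = (b - a) * W' (x t) (F (x t))"
    by auto
  moreover have "\<dots> \<le> 0"
    using \<open>a \<le> b\<close> W'_nonpos by (intro mult_nonneg_nonpos) auto
  ultimately show ?thesis
    by simp
qed

text \<open>Positivity of \<open>W\<close> is local, but the decrease condition is global, so
  \<open>W\<close> is nonincreasing along the whole solution, wherever it goes.\<close>

theorem lyapunov_direct_method:
  fixes F :: "'a::euclidean_space \<Rightarrow> 'a" and W :: "'a \<Rightarrow> real"
  assumes F0: "F 0 = 0"
    and W': "\<And>z. (W has_derivative W' z) (at z)"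
    and W'_nonpos: "\<And>z. W' z (F z) \<le> 0"
    and W0: "W 0 = 0"
    and nhd: "0 \<in> interior D" and pos: "\<And>z. z \<in> D - {0} \<Longrightarrow> 0 < W z"
  shows "lyapunov_stable_0 F"
  unfolding lyapunov_stable_0_def
proof (intro conjI allI impI)
  fix \<epsilon> :: real assume "0 < \<epsilon>"
  obtain R where R: "0 < R" "cball 0 R \<subseteq> D"
    using nhd by (auto simp: mem_interior_cball)
  \<comment> \<open>The bound \<open>R\<close> keeps the sphere of radius \<open>r\<close> inside
    \<open>D\<close>; halving \<epsilon> makes \<open>r < \<epsilon>\<close> strict.\<close>
  define r where "r = min R (\<epsilon> / 2)"
  have r: "0 < r" "r < \<epsilon>" "cball 0 r \<subseteq> D"
    using R \<open>0 < \<epsilon>\<close> by (auto simp: r_def)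
  have cont: "continuous_on UNIV W"
    using W' by (intro has_derivative_continuous_on) auto
  \<comment> \<open>The sphere is compact, so the minimum of \<open>W\<close> on it is attained and
    hence positive.\<close>
  obtain m where m: "m \<in> sphere 0 r" "\<And>z. z \<in> sphere 0 r \<Longrightarrow> W m \<le> W z"
    using continuous_attains_inf[of "sphere 0 r" W] continuous_on_subset[OF cont] r(1) by auto
  have "0 < W m"
    using m(1) r by (intro pos) auto
  moreover have "(W \<longlongrightarrow> W 0) (nhds 0)"
    using cont by (simp add: continuous_on_def flip: tendsto_at_iff_tendsto_nhds)
  ultimately have "\<forall>\<^sub>F z in nhds 0. W z < W m"
    using W0 by (auto dest: order_tendstoD(2))
  then obtain d where d: "0 < d" "\<And>z. norm z < d \<Longrightarrow> W z < W m"
    unfolding eventually_nhds_metric by auto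
  show "\<exists>\<delta>>0. \<forall>J x. is_interval J \<and> 0 \<in> J \<and> J \<subseteq> {0..} \<and> solution_on F J x \<and> norm (x 0) < \<delta>
        \<longrightarrow> (\<forall>t\<in>J. norm (x t) < \<epsilon>)"
  \<comment> \<open>Below \<open>d\<close> the initial value of \<open>W\<close> is less than the
    minimum on the sphere; below \<open>r\<close> the solution starts inside the sphere and must
    meet it before leaving the \<epsilon>-ball.\<close>
  proof (intro exI[of _ "min d r"] conjI allI impI ballI)
    fix J :: "real set" and x t
    assume "is_interval J \<and> 0 \<in> J \<and> J \<subseteq> {0..} \<and> solution_on F J x \<and> norm (x 0) < min d r"
      and "t \<in> J"
    then have sol: "solution_on F J x" and x0: "norm (x 0) < d" "norm (x 0) < r"
      and "0 \<le> t" and sub: "{0..t} \<subseteq> J"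
      by (auto simp: is_interval_1)
    show "norm (x t) < \<epsilon>"
    proof (rule ccontr)
      assume "\<not> norm (x t) < \<epsilon>"
      have "continuous_on J x"
        using sol unfolding solution_on_def
        by (meson continuous_on_eq_continuous_within has_vector_derivative_continuous)
      then have "continuous_on {0..t} (\<lambda>s. norm (x s))"
        using sub by (intro continuous_on_norm) (rule continuous_on_subset)
      then obtain s where s: "0 \<le> s" "s \<le> t" "norm (x s) = r"
        using IVT'[of "\<lambda>s. norm (x s)" 0 r t] x0 r \<open>\<not> norm (x t) < \<epsilon>\<close> \<open>0 \<le> t\<close> by auto
      have "W (x s) \<le> W (x 0)"
        using s sub by (intro nonincreasing_along_solution[OF W' W'_nonpos sol]) auto
      also have "\<dots> < W m"
        using d x0 by blast
      also have "\<dots> \<le> W (x s)"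
        using s by (intro m) auto
      finally show False
        by simp
    qed
  qed (use d r in auto)
qed (rule F0)

section \<open>The storage function of the interconnection\<close>

theorem theorem1:
  fixes f1 :: "(real ^ 'n1) \<times> real \<Rightarrow> real ^ 'n1"
    and h1 :: "real ^ 'n1 \<Rightarrow> real"
    and V1 :: "real ^ 'n1 \<Rightarrow> real"
    and f2 :: "(real ^ 'n2) \<times> real \<Rightarrow> real ^ 'n2"
    and h2 :: "(real ^ 'n2) \<times> real \<Rightarrow> real"
    and V2 :: "real ^ 'n2 \<Rightarrow> real"
    and D :: "((real ^ 'n1) \<times> (real ^ 'n2)) set"
  assumes f1_lipschitz: "\<exists>L1. L1-lipschitz_on UNIV f1"
    and f2_lipschitz: "\<exists>L2. L2-lipschitz_on UNIV f2"
    and h1_C1: "C1 h1"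
    and h2_C1: "C1 h2"
    and "f1 (0, 0) = 0" and "h1 0 = 0" and "f2 (0, 0) = 0" and "h2 (0, 0) = 0"
    and H1_NNI: "NNI_with_storage f1 (\<lambda>(x, u). h1 x) V1"
    and H2_NNI: "NNI_with_storage f2 h2 V2"
    and D_compact: "compact D"
    and D_nhd: "(0, 0) \<in> interior D"
    and W_pos: "\<And>x1 x2. (x1, x2) \<in> D - {(0, 0)} \<Longrightarrow>
                  interconnection_storage V1 V2 h1 h2 (x1, x2) > 0"
  shows "lyapunov_stable_0 (feedback_interconnection f1 h1 f2 h2)"
proof -
  let ?F = "feedback_interconnection f1 h1 f2 h2"
  let ?W = "interconnection_storage V1 V2 h1 h2"
  have frechet: "(g has_derivative frechet_derivative g (at z)) (at z)"
    if "C1 g" for g :: "'c::real_normed_vector \<Rightarrow> real" and z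
    using that unfolding C1_def by (meson differentiableI frechet_derivative_works)
  have V: "C1 V1" "C1 V2" "V1 0 = 0" "V2 0 = 0"
    using H1_NNI H2_NNI by (auto simp: NNI_with_storage_def)
  obtain hx where hx: "\<And>x t. ((\<lambda>x. h2 (x, t)) has_derivative blinfun_apply (hx x t)) (at x)"
    and cont_hx: "continuous_on UNIV (\<lambda>(x, t). hx x t)"
    using C1_partial[OF h2_C1] by blast
  have cont_h2: "continuous_on UNIV (\<lambda>(x, t). h2 (x, t))"
    using has_derivative_continuous_on[OF frechet[OF h2_C1]] by simp
  define V1' V2' h1' where "V1' = (\<lambda>z. frechet_derivative V1 (at z))"
    and "V2' = (\<lambda>z. frechet_derivative V2 (at z))"
    and "h1' = (\<lambda>z. frechet_derivative h1 (at z))"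
  have ders: "\<And>z. (V1 has_derivative V1' z) (at z)" "\<And>z. (V2 has_derivative V2' z) (at z)"
    "\<And>z. (h1 has_derivative h1' z) (at z)"
    unfolding V1'_def V2'_def h1'_def by (intro frechet V h1_C1)+
  \<comment> \<open>Chain rule applied to \<open>?W\<close>: the upper limit \<open>h1 x1\<close>
    contributes the boundary term \<open>h2 (x2, h1 x1) * h1' x1 v1\<close>.\<close>
  define W' where "W' = (\<lambda>(x1, x2) (v1, v2). V1' x1 v1 + V2' x2 v2 -
    ((LBINT t=ereal 0..ereal (h1 x1). hx x2 t v2) + h2 (x2, h1 x1) * h1' x1 v1))"
  show ?thesis
  proof (rule lyapunov_direct_method)
    show "?F 0 = 0"
      using assms by (simp add: feedback_interconnection_def zero_prod_def)
    show "?W 0 = 0"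
      using V \<open>h1 0 = 0\<close> by (simp add: interconnection_storage_def zero_prod_def)
    show "0 \<in> interior D"
      using D_nhd by (simp add: zero_prod_def)
    show "0 < ?W z" if "z \<in> D - {0}" for z
      using W_pos that by (cases z) (simp add: zero_prod_def)
    show "(?W has_derivative W' z) (at z)" for z
    proof -
      obtain x1 x2 where z: "z = (x1, x2)"
        by fastforce
      note fst' = has_derivative_fst[OF has_derivative_ident, of "at z"]
      note snd' = has_derivative_snd[OF has_derivative_ident, of "at z"]
      have 1: "((\<lambda>z. V1 (fst z)) has_derivative (\<lambda>v. V1' x1 (fst v))) (at z)"
        using has_derivative_compose[OF fst' ders(1)] by (simp add: z)
      have 2: "((\<lambda>z. V2 (snd z)) has_derivative (\<lambda>v. V2' x2 (snd v))) (at z)"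
        using has_derivative_compose[OF snd' ders(2)] by (simp add: z)
      have 3: "((\<lambda>z. h1 (fst z)) has_derivative (\<lambda>v. h1' x1 (fst v))) (at z)"
        using has_derivative_compose[OF fst' ders(3)] by (simp add: z)
      \<comment> \<open>The parametric integral, as a function of parameter and upper limit, is
        composed with the map sending \<open>z\<close> to
        \<open>(snd z, h1 (fst z))\<close>.\<close>
      have 4: "((\<lambda>z. LBINT t=ereal 0..ereal (h1 (fst z)). h2 (snd z, t)) has_derivative
        (\<lambda>v. (LBINT t=ereal 0..ereal (h1 x1). hx x2 t (snd v)) + h2 (x2, h1 x1) * h1' x1 (fst v))) (at z)"
        using has_derivative_compose[OF has_derivative_Pair[OF snd' 3],
            OF has_derivative_interval_integral_upper_parameter[OF hx cont_hx cont_h2, where a = 0]]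
        by (simp add: z)
      show ?thesis
        using has_derivative_diff[OF has_derivative_add[OF 1 2] 4]
        by (simp add: interconnection_storage_def W'_def case_prod_unfold z)
    qed
    show "W' z (?F z) \<le> 0" for z
    proof -
      obtain x1 x2 where z: "z = (x1, x2)"
        by fastforce
      define u1 u2 where "u1 = h2 (x2, h1 x1)" and "u2 = h1 x1"
      have "V1' x1 (f1 (x1, u1)) \<le> (LBINT \<xi>=ereal 0..ereal u1. h1' x1 (f1 (x1, u1)))"
        using H1_NNI by (simp add: NNI_with_storage_def V1'_def h1'_def)
      \<comment> \<open>The integrand is constant in \<xi>, since the output map of the first system
        depends on the state alone.\<close>
      also have "\<dots> = u1 * h1' x1 (f1 (x1, u1))"
        by simp
      finally have 1: "V1' x1 (f1 (x1, u1)) \<le> u1 * h1' x1 (f1 (x1, u1))" .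
      \<comment> \<open>Uniqueness of the derivative identifies the integrand of the dissipation
        inequality with \<open>hx\<close>.\<close>
      have partial: "frechet_derivative (\<lambda>x. h2 (x, t)) (at x2) = hx x2 t" for t
        by (rule frechet_derivative_at[OF hx, symmetric])
      have "V2' x2 (f2 (x2, u2)) \<le>
        (LBINT t=ereal 0..ereal u2. frechet_derivative (\<lambda>x. h2 (x, t)) (at x2) (f2 (x2, u2)))"
        using H2_NNI unfolding NNI_with_storage_def V2'_def by blast
      then have 2: "V2' x2 (f2 (x2, u2)) \<le> (LBINT t=ereal 0..ereal u2. hx x2 t (f2 (x2, u2)))"
        unfolding partial .
      \<comment> \<open>The right-hand sides of \<open>1\<close> and \<open>2\<close> are exactly
        the boundary term and the integral term subtracted in \<open>W'\<close>.\<close>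
      show ?thesis
        using 1 2 by (simp add: W'_def feedback_interconnection_def z u1_def u2_def)
    qed
  qed
qed

end
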